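(* For every matroid $M$ and every integer $i>0$, $$c_M(i) = \sum_{r=1}^i\;\sum_{S\subset [r]} (-1)^{|S|} \sum_{\substack{a_0<a_1<\cdots < a_r<a_{r+1}\\ a_0 = 0,\ a_r = i,\ a_{r+1} = \operatorname{rk} M-i}} W_M\Big(a_{t_{r}(S)} + a_{r-1},\ldots,a_{t_{1}(S)} + a_{0}\Big),$$ where the innermost sum is over sequences of integers $a_0,\dots,a_{r+1}$ satisfying the stated conditions.
   Context: Let $M$ be a matroid on a finite ground set $\mathcal{I}$ with lattice of flats $L$, and write $\hat 0$ for the minimal flat. For a flat $F$, the localization $M_F$ is the matroid on ground set $F$ whose lattice of flats is $\{G\in L : G\le F\}$, and the contraction $M^F$ is the matroid on $\mathcal{I}\smallsetminus F$ whose lattice of flats is isomorphic to $\{G\in L: G\ge F\}$. Set $\operatorname{rk} F := \operatorname{rk} M_F$ and $\operatorname{crk} F := \operatorname{rk} M - \operatorname{rk} F$. Let $\mu$ be the Möbius function of $L$ and $\chi_M(t)=\sum_{F}\mu(\hat 0,F)t^{\operatorname{crk} F}$ the characteristic polynomial. The Kazhdan–Lusztig polynomial $P_M(t)\in\mathbb{Z}[t]$ is the unique assignment of a polynomial to every matroid such that: $P_M(t)=1$ if $\operatorname{rk} M=0$; $\deg P_M(t)<\tfrac12\operatorname{rk} M$ if $\operatorname{rk} M>0$; and $t^{\operatorname{rk} M}P_M(t^{-1})=\sum_{F\in L}\chi_{M_F}(t)P_{M^F}(t)$. Let $c_M(i)$ be the coefficient of $t^i$ in $P_M(t)$. For integers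 $i_r,\dots,i_1$, the $r$-Whitney number is $W_M(i_r,\ldots,i_1) := \#\{(F_r,\ldots,F_1)\in L^r : F_r\le F_{r-1}\le\cdots\le F_1,\ \operatorname{crk}F_j=i_j \text{ for all } j\}$. For a positive integer $r$ and $S\subset[r]=\{1,\dots,r\}$, and $1\le j\le r$, let $t_j(S):=\min\{k : k\ge j,\ k\notin S\}\in\{1,\dots,r+1\}$. *)

theory Defs
  imports "HOL-Computational_Algebra.Polynomial" "HOL-Library.FuncSet"
begin

definition is_matroid :: "'a set \<Rightarrow> 'a set set \<Rightarrow> bool" where
  "is_matroid E \<I> \<longleftrightarrow> finite E \<and> \<I> \<subseteq> Pow E \<and> {} \<in> \<I> \<and>
     (\<forall>X\<in>\<I>. \<forall>Y. Y \<subseteq> X \<longrightarrow> Y \<in> \<I>) \<and>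
     (\<forall>X\<in>\<I>. \<forall>Y\<in>\<I>. card X < card Y \<longrightarrow> (\<exists>y\<in>Y - X. insert y X \<in> \<I>))"

typedef 'a matroid = "{(E :: 'a set, \<I>). is_matroid E \<I>}"
  by (rule exI[of _ "({}, {{}})"]) (auto simp: is_matroid_def)

definition ground :: "'a matroid \<Rightarrow> 'a set" where
  "ground M = fst (Rep_matroid M)"

definition indep :: "'a matroid \<Rightarrow> 'a set set" where
  "indep M = snd (Rep_matroid M)"

definition rank_of :: "'a matroid \<Rightarrow> 'a set \<Rightarrow> nat" where
  "rank_of M X = Max (card ` {I \<in> indep M. I \<subseteq> X})"

definition rk :: "'a matroid \<Rightarrow> nat" where
  "rk M = rank_of M (ground M)"

definition flats :: "'a matroid \<Rightarrow> 'a set set" where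
  "flats M = {F. F \<subseteq> ground M \<and> (\<forall>x\<in>ground M - F. rank_of M F < rank_of M (insert x F))}"

definition min_flat :: "'a matroid \<Rightarrow> 'a set" where
  "min_flat M = \<Inter> (flats M)"

definition basis_of :: "'a matroid \<Rightarrow> 'a set \<Rightarrow> 'a set \<Rightarrow> bool" where
  "basis_of M X B \<longleftrightarrow> B \<in> indep M \<and> B \<subseteq> X \<and> (\<forall>x\<in>X - B. insert x B \<notin> indep M)"

definition localization :: "'a matroid \<Rightarrow> 'a set \<Rightarrow> 'a matroid" where
  "localization M F = Abs_matroid (ground M \<inter> F, {I \<in> indep M. I \<subseteq> F})"

definition contraction :: "'a matroid \<Rightarrow> 'a set \<Rightarrow> 'a matroid" where
  "contraction M F =
     Abs_matroid (ground M - F, {I. I \<subseteq> ground M - F \<and> (\<exists>B. basis_of M F B \<and> I \<union> B \<in> indep M)})"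

text \<open>
  Natural number subtraction does not truncate here, since the rank is monotone.
\<close>
definition crk :: "'a matroid \<Rightarrow> 'a set \<Rightarrow> nat" where
  "crk M F = rk M - rk (localization M F)"

text \<open>
  The family \<open>L\<close> is ordered by inclusion; \<open>finite Y\<close> only serves termination.
\<close>
function mobius :: "'a set set \<Rightarrow> 'a set \<Rightarrow> 'a set \<Rightarrow> int" where
  "mobius L X Y =
     (if X = Y then 1
      else if X \<subset> Y \<and> finite Y then - (\<Sum>Z | Z \<in> L \<and> X \<subseteq> Z \<and> Z \<subset> Y. mobius L X Z)
      else 0)"
  by pat_completeness auto
termination
  by (relation "measure (\<lambda>(L, X, Y). card Y)") (auto intro: psubset_card_mono)

declare mobius.simps [simp del]

definition char_poly :: "'a matroid \<Rightarrow> int poly" where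
  "char_poly M = (\<Sum>F\<in>flats M. monom (mobius (flats M) (min_flat M) F) (crk M F))"

text \<open>
  For \<open>degree p \<le> n\<close> this is \<open>t ^ n * p (1 / t)\<close>, see \<open>poly_rev_poly\<close> below. The first two
  conditions of \<open>is_KL_assignment\<close> ensure this degree bound in the third one.
\<close>
definition rev_poly :: "nat \<Rightarrow> 'a::comm_monoid_add poly \<Rightarrow> 'a poly" where
  "rev_poly n p = (\<Sum>i\<le>degree p. monom (coeff p i) (n - i))"

text \<open>
  The second condition also admits the zero polynomial, whose \<open>degree\<close> is \<open>0\<close>.
\<close>
definition is_KL_assignment :: "('a matroid \<Rightarrow> int poly) \<Rightarrow> bool" where
  "is_KL_assignment P \<longleftrightarrow>
     (\<forall>M. rk M = 0 \<longrightarrow> P M = 1) \<and>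
     (\<forall>M. rk M > 0 \<longrightarrow> 2 * degree (P M) < rk M) \<and>
     (\<forall>M. rev_poly (rk M) (P M) =
        (\<Sum>F\<in>flats M. char_poly (localization M F) * P (contraction M F)))"

definition KL_poly :: "'a matroid \<Rightarrow> int poly" where
  "KL_poly = (THE P. is_KL_assignment P)"

text \<open>
  \<open>whitney M r w\<close> is the number of chains \<open>F r \<subseteq> \<dots> \<subseteq> F 1\<close> of flats with
  \<open>crk M (F j) = w j\<close>. The values \<open>w j\<close> are integers; a negative one gives \<open>0\<close>.
\<close>
definition whitney :: "'a matroid \<Rightarrow> nat \<Rightarrow> (nat \<Rightarrow> int) \<Rightarrow> nat" where
  "whitney M r w =
     card {F \<in> {1..r} \<rightarrow>\<^sub>E flats M.
             (\<forall>j\<in>{1..<r}. F (j + 1) \<subseteq> F j) \<and> (\<forall>j\<in>{1..r}. int (crk M (F j)) = w j)}"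

definition next_notin :: "nat set \<Rightarrow> nat \<Rightarrow> nat" where
  "next_notin S j = (LEAST k. k \<ge> j \<and> k \<notin> S)"

text \<open>
  The sequences \<open>a\<^sub>0 < \<dots> < a\<^sub>r < a\<^sub>r\<^sub>+\<^sub>1\<close> with \<open>a\<^sub>0 = 0\<close>, \<open>a\<^sub>r = i\<close>, \<open>a\<^sub>r\<^sub>+\<^sub>1 = d - i\<close>; integers are
  needed because \<open>d - i\<close> may be negative.
\<close>
definition index_seqs :: "nat \<Rightarrow> nat \<Rightarrow> nat \<Rightarrow> (nat \<Rightarrow> int) set" where
  "index_seqs d i r =
     {a \<in> {0..r + 1} \<rightarrow>\<^sub>E UNIV. strict_mono_on {0..r + 1} a \<and>
        a 0 = 0 \<and> a r = int i \<and> a (r + 1) = int d - int i}"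

lemma poly_rev_poly:
  fixes p :: "'a::field poly"
  assumes "degree p \<le> n" and "x \<noteq> 0"
  shows "poly (rev_poly n p) x = x ^ n * poly p (1 / x)"
proof -
  have "poly (rev_poly n p) x = (\<Sum>i\<le>degree p. coeff p i * x ^ (n - i))"
    by (simp add: rev_poly_def poly_sum poly_monom)
  also have "\<dots> = (\<Sum>i\<le>degree p. x ^ n * (coeff p i * (1 / x) ^ i))"
    using assms by (intro sum.cong) (auto simp: power_diff power_divide)
  also have "\<dots> = x ^ n * poly p (1 / x)"
    by (simp add: poly_altdef sum_distrib_left)
  finally show ?thesis .
qed

lemma finite_index_seqs: "finite (index_seqs d i r)"
proof (rule finite_subset)
  show "index_seqs d i r \<subseteq> {0..r + 1} \<rightarrow>\<^sub>E {0..int d - int i}"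
  proof
    fix a assume a: "a \<in> index_seqs d i r"
    have "a j \<in> {0..int d - int i}" if "j \<in> {0..r + 1}" for j
    proof -
      have sm: "strict_mono_on {0..r + 1} a" and "a 0 = 0" "a (r + 1) = int d - int i"
        using a by (auto simp: index_seqs_def)
      moreover have "a 0 \<le> a j" "a j \<le> a (r + 1)"
        using that by (auto intro!: strict_mono_on_leD[OF sm])
      ultimately show ?thesis by auto
    qed
    then show "a \<in> {0..r + 1} \<rightarrow>\<^sub>E {0..int d - int i}"
      using a by (auto simp: index_seqs_def PiE_def Pi_def)
  qed
qed (auto intro: finite_PiE)

lemma is_matroid_ground_indep: "is_matroid (ground M) (indep M)"
  using Rep_matroid[of M] by (auto simp: ground_def indep_def split: prod.splits)

lemma finite_ground [simp]: "finite (ground M)"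
  and indep_subset: "X \<in> indep M \<Longrightarrow> X \<subseteq> ground M"
  and empty_indep [simp]: "{} \<in> indep M"
  and indep_mono: "X \<in> indep M \<Longrightarrow> Y \<subseteq> X \<Longrightarrow> Y \<in> indep M"
  and indep_exchange:
    "X \<in> indep M \<Longrightarrow> Y \<in> indep M \<Longrightarrow> card X < card Y \<Longrightarrow> \<exists>y\<in>Y - X. insert y X \<in> indep M"
  using is_matroid_ground_indep[of M] unfolding is_matroid_def by auto

lemma finite_indep: "X \<in> indep M \<Longrightarrow> finite X"
  by (meson finite_ground finite_subset indep_subset)

lemma finite_indeps: "finite (indep M)"
  by (rule finite_subset[of _ "Pow (ground M)"]) (auto dest: indep_subset)

lemma finite_flats: "finite (flats M)"
  by (rule finite_subset[of _ "Pow (ground M)"]) (auto simp: flats_def)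

lemma ground_Abs: "is_matroid E \<I> \<Longrightarrow> ground (Abs_matroid (E, \<I>)) = E"
  and indep_Abs: "is_matroid E \<I> \<Longrightarrow> indep (Abs_matroid (E, \<I>)) = \<I>"
  by (simp_all add: ground_def indep_def Abs_matroid_inverse)

lemma basis_card_eq:
  assumes "basis_of M X B" "basis_of M X B'"
  shows "card B = card B'"
proof -
  have "card B' \<le> card B" if "basis_of M X B" "basis_of M X B'" for B B'
    using indep_exchange[of B M B'] that unfolding basis_of_def
    by (meson Diff_iff Diff_mono linorder_not_le order_refl subsetD)
  then show ?thesis using assms by (simp add: le_antisym)
qed

lemma basis_extend:
  assumes "I \<in> indep M" "I \<subseteq> X"
  shows "\<exists>B. basis_of M X B \<and> I \<subseteq> B"
proof -
  have "finite {J \<in> indep M. I \<subseteq> J \<and> J \<subseteq> X}" using finite_indeps[of M] by simp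
  moreover have "I \<in> {J \<in> indep M. I \<subseteq> J \<and> J \<subseteq> X}" using assms by simp
  ultimately obtain B where B: "B \<in> {J \<in> indep M. I \<subseteq> J \<and> J \<subseteq> X}"
    and mx: "\<And>J. J \<in> {J \<in> indep M. I \<subseteq> J \<and> J \<subseteq> X} \<Longrightarrow> B \<subseteq> J \<Longrightarrow> J = B"
    using finite_has_maximal2[of "{J \<in> indep M. I \<subseteq> J \<and> J \<subseteq> X}" I] by auto metis
  have "insert x B \<notin> indep M" if "x \<in> X - B" for x
    using mx[of "insert x B"] B that by auto
  then show ?thesis using B unfolding basis_of_def by blast
qed

lemma rank_of_basis:
  assumes "basis_of M X B"
  shows "rank_of M X = card B"
  unfolding rank_of_def
proof (rule Max_eqI)
  show "finite (card ` {I \<in> indep M. I \<subseteq> X})" using finite_indeps[of M] by simp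
  show "card B \<in> card ` {I \<in> indep M. I \<subseteq> X}" using assms by (auto simp: basis_of_def)
  fix n assume "n \<in> card ` {I \<in> indep M. I \<subseteq> X}"
  then obtain I where I: "I \<in> indep M" "I \<subseteq> X" "n = card I" by auto
  then obtain B' where B': "basis_of M X B'" "I \<subseteq> B'" using basis_extend by blast
  then have "card I \<le> card B'" by (auto intro!: card_mono finite_indep simp: basis_of_def)
  then show "n \<le> card B" using basis_card_eq[OF assms B'(1)] I by simp
qed

lemma basis_exists: "\<exists>B. basis_of M X B"
  using basis_extend[of "{}" M X] by auto

lemma rank_less_insert_iff:
  assumes B: "basis_of M X B" and x: "x \<notin> X"
  shows "rank_of M X < rank_of M (insert x X) \<longleftrightarrow> insert x B \<in> indep M"
proof
  assume "insert x B \<in> indep M"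
  moreover have "basis_of M (insert x X) (insert x B)" if "insert x B \<in> indep M"
    unfolding basis_of_def
  proof (intro conjI ballI)
    fix y assume y: "y \<in> insert x X - insert x B"
    then have "insert y B \<notin> indep M" using B by (auto simp: basis_of_def)
    then show "insert y (insert x B) \<notin> indep M" using indep_mono[of _ M "insert y B"] by blast
  qed (use that B in \<open>auto simp: basis_of_def\<close>)
  moreover have "card (insert x B) = Suc (card B)"
    using B x finite_indep by (subst card_insert_disjoint) (auto simp: basis_of_def)
  ultimately show "rank_of M X < rank_of M (insert x X)"
    using B by (simp add: rank_of_basis)
next
  assume less: "rank_of M X < rank_of M (insert x X)"
  show "insert x B \<in> indep M"
  proof (rule ccontr)
    assume "insert x B \<notin> indep M"
    then have "basis_of M (insert x X) B" using B by (auto simp: basis_of_def)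
    then show False using less B by (simp add: rank_of_basis)
  qed
qed

lemma flats_iff_basis:
  assumes "basis_of M F B"
  shows "F \<in> flats M \<longleftrightarrow> F \<subseteq> ground M \<and> (\<forall>x\<in>ground M - F. insert x B \<in> indep M)"
  using rank_less_insert_iff[OF assms] by (auto simp: flats_def)

lemma is_matroid_localization: "is_matroid (ground M \<inter> F) {I \<in> indep M. I \<subseteq> F}"
  unfolding is_matroid_def
proof (intro conjI ballI impI allI)
  fix X Y assume XY: "X \<in> {I \<in> indep M. I \<subseteq> F}" "Y \<in> {I \<in> indep M. I \<subseteq> F}" "card X < card Y"
  then obtain y where "y \<in> Y - X" "insert y X \<in> indep M" using indep_exchange[of X M Y] by auto
  then show "\<exists>y\<in>Y - X. insert y X \<in> {I \<in> indep M. I \<subseteq> F}" using XY by auto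
qed (auto dest: indep_subset indep_mono)

lemma is_matroid_contraction:
  "is_matroid (ground M - F)
     {I. I \<subseteq> ground M - F \<and> (\<exists>B. basis_of M F B \<and> I \<union> B \<in> indep M)}" (is "is_matroid _ ?I")
  unfolding is_matroid_def
proof (intro conjI ballI impI allI)
  show "{} \<in> ?I" using basis_exists[of M F] by (auto simp: basis_of_def)
next
  fix X Y assume X: "X \<in> ?I" and "Y \<subseteq> X"
  then show "Y \<in> ?I" by (auto intro: indep_mono[of "X \<union> _" M "Y \<union> _"])
next
  fix X Y assume X: "X \<in> ?I" and Y: "Y \<in> ?I" and less: "card X < card Y"
  from X obtain B where B: "basis_of M F B" "X \<union> B \<in> indep M" by auto
  from Y obtain C where C: "basis_of M F C" "Y \<union> C \<in> indep M" by auto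
  have "card (X \<union> B) = card X + card B" "card (Y \<union> C) = card Y + card C"
    using X Y B C finite_indep[OF B(2)] finite_indep[OF C(2)]
    by (auto intro!: card_Un_disjoint simp: basis_of_def)
  then have "card (X \<union> B) < card (Y \<union> C)" using less basis_card_eq[OF B(1) C(1)] by simp
  then obtain y where y: "y \<in> Y \<union> C - (X \<union> B)" "insert y (X \<union> B) \<in> indep M"
    using indep_exchange[OF B(2) C(2)] by auto
  have "insert y B \<in> indep M" using indep_mono[OF y(2)] by blast
  then have "y \<notin> F" using y B by (auto simp: basis_of_def)
  then have "y \<in> Y - X" using y C by (auto simp: basis_of_def)
  moreover have "insert y X \<in> ?I" using y X Y B calculation by auto
  ultimately show "\<exists>y\<in>Y - X. insert y X \<in> ?I" by blast
qed auto

lemma ground_localization: "ground (localization M F) = ground M \<inter> F"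
  and indep_localization: "indep (localization M F) = {I \<in> indep M. I \<subseteq> F}"
  using is_matroid_localization[of M F] by (simp_all add: localization_def ground_Abs indep_Abs)

lemma ground_contraction: "ground (contraction M F) = ground M - F"
  and indep_contraction: "indep (contraction M F) =
    {I. I \<subseteq> ground M - F \<and> (\<exists>B. basis_of M F B \<and> I \<union> B \<in> indep M)}"
  using is_matroid_contraction[of M F] by (simp_all add: contraction_def ground_Abs indep_Abs)

lemma flats_localization:
  assumes F: "F \<in> flats M"
  shows "flats (localization M F) = {G \<in> flats M. G \<subseteq> F}"
proof -
  have FE: "F \<subseteq> ground M" using F by (simp add: flats_def)
  have "G \<in> flats (localization M F) \<longleftrightarrow> G \<in> flats M" if GF: "G \<subseteq> F" for G
  proof -
    obtain B where B: "basis_of M G B" using basis_exists by blast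
    have B': "basis_of (localization M F) G B"
      using B GF by (auto simp: basis_of_def indep_localization)
    have "B \<in> indep M" "B \<subseteq> F" using B GF by (auto simp: basis_of_def)
    then obtain C where C: "basis_of M F C" "B \<subseteq> C" using basis_extend by blast
    have "insert x B \<in> indep M" if "x \<in> ground M - F" for x
    proof -
      have "insert x C \<in> indep M" using F that by (simp add: flats_iff_basis[OF C(1)])
      then show ?thesis using C(2) by (auto intro: indep_mono)
    qed
    then show ?thesis
      using FE GF \<open>B \<subseteq> F\<close>
      unfolding flats_iff_basis[OF B] flats_iff_basis[OF B'] ground_localization indep_localization
      by blast
  qed
  moreover have "G \<subseteq> F" if "G \<in> flats (localization M F)" for G
    using that by (auto simp: flats_def ground_localization)
  ultimately show ?thesis by blast
qed

lemma indep_contraction_basis: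
  assumes B: "basis_of M F B" and I: "I \<subseteq> ground M - F"
  shows "I \<in> indep (contraction M F) \<longleftrightarrow> I \<union> B \<in> indep M"
proof
  assume "I \<in> indep (contraction M F)"
  then obtain C where C: "basis_of M F C" "I \<union> C \<in> indep M" by (auto simp: indep_contraction)
  have "B \<in> indep M" "B \<subseteq> I \<union> F" using B by (auto simp: basis_of_def)
  then obtain D where D: "basis_of M (I \<union> F) D" "B \<subseteq> D" using basis_extend by blast
  have "D \<inter> F \<subseteq> B"
  proof
    fix x assume x: "x \<in> D \<inter> F"
    then have "insert x B \<in> indep M" using D by (auto simp: basis_of_def intro: indep_mono)
    then show "x \<in> B" using x B by (auto simp: basis_of_def)
  qed
  then have DI: "D \<subseteq> I \<union> B" using D by (auto simp: basis_of_def)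
  have "I \<union> C \<subseteq> I \<union> F" using C by (auto simp: basis_of_def)
  then obtain C' where C': "basis_of M (I \<union> F) C'" "I \<union> C \<subseteq> C'" using basis_extend[OF C(2)] by blast
  have "finite (I \<union> B)" "finite C'" using C B C' by (auto simp: basis_of_def dest: finite_indep)
  have "card (I \<union> B) \<le> card I + card B" by (rule card_Un_le)
  also have "\<dots> = card I + card C" using basis_card_eq[OF B C(1)] by simp
  also have "\<dots> = card (I \<union> C)"
    using C I finite_indep[OF C(2)] by (intro card_Un_disjoint[symmetric]) (auto simp: basis_of_def)
  also have "\<dots> \<le> card C'" using C'(2) \<open>finite C'\<close> by (rule card_mono[rotated])
  also have "\<dots> = card D" using basis_card_eq[OF C'(1) D(1)] .
  finally have "D = I \<union> B" using DI \<open>finite (I \<union> B)\<close> by (metis card_seteq)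
  then show "I \<union> B \<in> indep M" using D by (simp add: basis_of_def)
qed (use assms in \<open>auto simp: indep_contraction\<close>)

lemma flats_contraction:
  assumes F: "F \<in> flats M"
  shows "flats (contraction M F) = (\<lambda>G. G - F) ` {G \<in> flats M. F \<subseteq> G}"
proof -
  have FE: "F \<subseteq> ground M" using F by (simp add: flats_def)
  obtain B where B: "basis_of M F B" using basis_exists by blast
  have key: "G \<in> flats (contraction M F) \<longleftrightarrow> G \<union> F \<in> flats M" if G: "G \<subseteq> ground M - F" for G
  proof -
    obtain D where D: "basis_of (contraction M F) G D" using basis_exists by blast
    have DG: "D \<subseteq> G" using D by (simp add: basis_of_def)
    have DB: "D \<union> B \<in> indep M"
      using D DG G indep_contraction_basis[OF B, of D] by (auto simp: basis_of_def)
    have ins: "insert x D \<in> indep (contraction M F) \<longleftrightarrow> insert x (D \<union> B) \<in> indep M"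
      if "x \<in> ground M - F" for x
      using indep_contraction_basis[OF B, of "insert x D"] that DG G by auto
    have "basis_of M (G \<union> F) (D \<union> B)"
      unfolding basis_of_def
    proof (intro conjI ballI)
      fix x assume x: "x \<in> G \<union> F - (D \<union> B)"
      show "insert x (D \<union> B) \<notin> indep M"
      proof (cases "x \<in> F")
        case True
        then have "insert x B \<notin> indep M" using x B by (auto simp: basis_of_def)
        then show ?thesis using indep_mono[of "insert x (D \<union> B)" M "insert x B"] by blast
      next
        case False
        then show ?thesis using x ins[of x] D G by (auto simp: basis_of_def)
      qed
    qed (use DB DG B in \<open>auto simp: basis_of_def\<close>)
    then show ?thesis
      using G FE ins
      by (auto simp: flats_iff_basis[OF D] flats_iff_basis[of M "G \<union> F"] ground_contraction)
  qed
  show ?thesis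
  proof (intro equalityI subsetI)
    fix G assume G: "G \<in> flats (contraction M F)"
    then have GE: "G \<subseteq> ground M - F" by (simp add: flats_def ground_contraction)
    then have "G = (G \<union> F) - F" by auto
    then show "G \<in> (\<lambda>G. G - F) ` {G \<in> flats M. F \<subseteq> G}" using key[OF GE] G by blast
  next
    fix H assume "H \<in> (\<lambda>G. G - F) ` {G \<in> flats M. F \<subseteq> G}"
    then obtain G where G: "G \<in> flats M" "F \<subseteq> G" "H = G - F" by auto
    then have "H \<subseteq> ground M - F" "H \<union> F = G" by (auto simp: flats_def)
    then show "H \<in> flats (contraction M F)" using key[of H] G by simp
  qed
qed

lemma min_flat_in_flats: "min_flat M \<in> flats M"
proof -
  define Z where "Z = {x \<in> ground M. {x} \<notin> indep M}"
  have B: "basis_of M Z {}" by (auto simp: basis_of_def Z_def)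
  have Z: "Z \<in> flats M" by (auto simp: flats_iff_basis[OF B]) (auto simp: Z_def)
  have "Z \<subseteq> F" if F: "F \<in> flats M" for F
  proof
    fix x assume x: "x \<in> Z"
    obtain C where C: "basis_of M F C" using basis_exists by blast
    show "x \<in> F"
    proof (rule ccontr)
      assume "x \<notin> F"
      then have "insert x C \<in> indep M" using x F by (auto simp: flats_iff_basis[OF C] Z_def)
      then have "{x} \<in> indep M" by (rule indep_mono) auto
      then show False using x by (simp add: Z_def)
    qed
  qed
  then have "min_flat M = Z" using Z by (auto simp: min_flat_def)
  then show ?thesis using Z by simp
qed

end

theory Submission
  imports Defs
begin

text \<open>
  Write \<open>d = rk M\<close>. By Moebius inversion the defining recursion of the Kazhdan--Lusztig polynomials
  says that \<open>\<Sum>F. t ^ rk F * P\<^bsub>M\<^sup>F\<^esub>\<close> is palindromic of degree \<open>d\<close>, for every matroid. Comparing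
  the coefficients in degrees \<open>i\<close> and \<open>d - i\<close> for \<open>0 < 2 * i < d\<close>, and dropping those that vanish
  for degree reasons, gives \<open>c\<^sub>M(i)\<close> as the sum over \<open>j < i\<close> of \<open>c\<^bsub>M\<^sup>F\<^esub>(j)\<close> over the flats with
  \<open>crk F = i + j\<close>, minus the same sum over the flats with \<open>crk F = (d - i) + j\<close>. Iterating this, with
  \<open>a\<^sub>r = i\<close>, \<open>a\<^sub>r\<^sub>-\<^sub>1 = j\<close> and so on, counts chains of flats; the set \<open>S\<close> records the steps at which
  the negative sum was chosen, and such a choice passes \<open>a\<^sub>r\<^sub>+\<^sub>1\<close> instead of \<open>a\<^sub>r\<close> down to \<open>M\<^sup>F\<close>.
\<close>

section \<open>Ranks in contractions\<close>

lemma matroid_eqI: "ground M = ground N \<Longrightarrow> indep M = indep N \<Longrightarrow> M = N"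
  by (simp add: ground_def indep_def prod_eq_iff flip: Rep_matroid_inject)

lemma rank_of_mono:
  assumes "X \<subseteq> Y"
  shows "rank_of M X \<le> rank_of M Y"
proof -
  obtain B where B: "basis_of M X B" using basis_exists by blast
  then obtain C where C: "basis_of M Y C" "B \<subseteq> C"
    using basis_extend[of B M Y] assms by (auto simp: basis_of_def)
  then have "card B \<le> card C" by (auto intro!: card_mono finite_indep simp: basis_of_def)
  then show ?thesis using B C by (simp add: rank_of_basis)
qed

lemma rk_localization: "rk (localization M F) = rank_of M F"
proof -
  have "{I \<in> indep M. I \<subseteq> F \<and> I \<subseteq> ground M} = {I \<in> indep M. I \<subseteq> F}"
    by (auto dest: indep_subset)
  then show ?thesis
    by (simp add: rk_def rank_of_def ground_localization indep_localization conj_ac)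
qed

lemma rank_of_localization: "G \<subseteq> F \<Longrightarrow> rank_of (localization M F) G = rank_of M G"
  unfolding rank_of_def indep_localization by (rule arg_cong[where f = Max]) auto

lemma crk_eq: "crk M F = rk M - rank_of M F"
  by (simp add: crk_def rk_localization)

lemma flat_subset_ground: "F \<in> flats M \<Longrightarrow> F \<subseteq> ground M"
  by (simp add: flats_def)

lemma finite_flat: "F \<in> flats M \<Longrightarrow> finite F"
  using flat_subset_ground finite_ground finite_subset by metis

lemma rank_of_flat_le: "F \<in> flats M \<Longrightarrow> rank_of M F \<le> rk M"
  unfolding rk_def by (intro rank_of_mono flat_subset_ground)

lemma crk_add_rank_of: "F \<in> flats M \<Longrightarrow> crk M F + rank_of M F = rk M"
  using rank_of_flat_le[of F M] by (simp add: crk_eq)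

lemma ground_in_flats: "ground M \<in> flats M"
  by (simp add: flats_def)

lemma rank_of_flat_strict_mono:
  assumes "F \<in> flats M" "G \<in> flats M" "F \<subset> G"
  shows "rank_of M F < rank_of M G"
proof -
  obtain x where x: "x \<in> G - F" using assms by auto
  then have "rank_of M F < rank_of M (insert x F)"
    using assms flat_subset_ground[of G M] by (auto simp: flats_def)
  also have "\<dots> \<le> rank_of M G" using x assms by (intro rank_of_mono) auto
  finally show ?thesis .
qed

lemma min_flat_subset: "F \<in> flats M \<Longrightarrow> min_flat M \<subseteq> F"
  by (auto simp: min_flat_def)

lemma rank_of_min_flat: "rank_of M (min_flat M) = 0"
proof -
  \<comment> \<open>\<open>Z\<close> is the set of loops. It is a flat with basis \<open>{}\<close>,
    so \<open>min_flat M\<close>, which lies inside it, has rank 0.\<close>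
  define Z where "Z = {x \<in> ground M. {x} \<notin> indep M}"
  have B: "basis_of M Z {}" by (auto simp: basis_of_def Z_def)
  have "Z \<in> flats M" by (auto simp: flats_iff_basis[OF B]) (auto simp: Z_def)
  then have "rank_of M (min_flat M) \<le> rank_of M Z" by (intro rank_of_mono min_flat_subset)
  then show ?thesis using rank_of_basis[OF B] by simp
qed

lemma rank_of_flat_eq_0_iff:
  assumes "F \<in> flats M"
  shows "rank_of M F = 0 \<longleftrightarrow> F = min_flat M"
  using rank_of_flat_strict_mono[OF min_flat_in_flats assms] min_flat_subset[OF assms]
  by (metis psubsetI less_nat_zero_code rank_of_min_flat)

lemma crk_flat_eq_0_iff:
  assumes "F \<in> flats M"
  shows "crk M F = 0 \<longleftrightarrow> F = ground M"
proof
  assume "crk M F = 0"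
  then have "\<not> rank_of M F < rank_of M (ground M)" by (simp add: crk_eq rk_def)
  then show "F = ground M"
    using rank_of_flat_strict_mono[OF assms ground_in_flats] flat_subset_ground[OF assms] by blast
qed (simp add: crk_eq rk_def)

text \<open>Bases of \<open>F\<close> and of \<open>H\<close> in the contraction glue together: an
  element of \<open>F\<close> outside \<open>B\<close> is already dependent on \<open>B\<close>, and
  an element of \<open>H\<close> outside \<open>D\<close> is rejected by the contraction.\<close>

lemma basis_of_contraction:
  assumes B: "basis_of M F B" and H: "H \<subseteq> ground M - F"
    and D: "basis_of (contraction M F) H D"
  shows "basis_of M (H \<union> F) (D \<union> B)"
  unfolding basis_of_def
proof (intro conjI ballI)
  have DH: "D \<subseteq> H" using D by (simp add: basis_of_def)
  show "D \<union> B \<in> indep M"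
    using D DH H indep_contraction_basis[OF B, of D] by (auto simp: basis_of_def)
  show "D \<union> B \<subseteq> H \<union> F" using DH B by (auto simp: basis_of_def)
  fix x assume x: "x \<in> H \<union> F - (D \<union> B)"
  show "insert x (D \<union> B) \<notin> indep M"
  proof (cases "x \<in> F")
    case True
    then have "insert x B \<notin> indep M" using x B by (auto simp: basis_of_def)
    then show ?thesis using indep_mono[of "insert x (D \<union> B)" M "insert x B"] by blast
  next
    case False
    then have "insert x D \<notin> indep (contraction M F)" using x D by (auto simp: basis_of_def)
    then show ?thesis
      using indep_contraction_basis[OF B, of "insert x D"] x False DH H by auto
  qed
qed

text \<open>The glued basis is a disjoint union, so the cardinalities add. The additive form avoids
  truncated subtraction.\<close>

lemma rank_of_contraction:
  assumes "F \<subseteq> G" "G \<subseteq> ground M"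
  shows "rank_of (contraction M F) (G - F) + rank_of M F = rank_of M G"
proof -
  obtain B where B: "basis_of M F B" using basis_exists by blast
  obtain D where D: "basis_of (contraction M F) (G - F) D" using basis_exists by blast
  have DB: "basis_of M (G - F \<union> F) (D \<union> B)"
    using assms by (intro basis_of_contraction B D) auto
  then have "finite (D \<union> B)" unfolding basis_of_def using finite_indep by blast
  then have "card (D \<union> B) = card D + card B"
    using B D by (intro card_Un_disjoint) (auto simp: basis_of_def)
  moreover have "G - F \<union> F = G" using assms by auto
  ultimately show ?thesis
    using rank_of_basis[OF B] rank_of_basis[OF D] rank_of_basis[OF DB] by simp
qed

lemma rk_contraction: "F \<in> flats M \<Longrightarrow> rk (contraction M F) = crk M F"
  using rank_of_contraction[of F "ground M" M] crk_add_rank_of[of F M]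
  by (simp add: rk_def ground_contraction flat_subset_ground)

lemma crk_contraction:
  assumes "F \<in> flats M" "G \<in> flats M" "F \<subseteq> G"
  shows "crk (contraction M F) (G - F) = crk M G"
  using rank_of_contraction[of F G M] crk_add_rank_of[of F M] crk_add_rank_of[of G M] assms
  by (simp add: crk_eq[of "contraction M F"] rk_contraction flat_subset_ground)

text \<open>On both sides, independence of \<open>I\<close> reduces to that of
  \<open>I \<union> D \<union> B\<close> in \<open>M\<close>, where \<open>D \<union> B\<close> is a
  basis of \<open>G\<close>. Recursions through repeated contractions thus stay among the
  contractions of \<open>M\<close> itself.\<close>

lemma contraction_contraction:
  assumes "F \<subseteq> G" "G \<subseteq> ground M"
  shows "contraction (contraction M F) (G - F) = contraction M G"
proof (rule matroid_eqI)
  show gr: "ground (contraction (contraction M F) (G - F)) = ground (contraction M G)"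
    using assms by (auto simp: ground_contraction)
  obtain B where B: "basis_of M F B" using basis_exists by blast
  obtain D where D: "basis_of (contraction M F) (G - F) D" using basis_exists by blast
  have "basis_of M (G - F \<union> F) (D \<union> B)"
    using assms by (intro basis_of_contraction B D) auto
  moreover have "G - F \<union> F = G" using assms by auto
  ultimately have DB: "basis_of M G (D \<union> B)" by simp
  have DG: "D \<subseteq> G - F" using D by (simp add: basis_of_def)
  have "I \<in> indep (contraction (contraction M F) (G - F)) \<longleftrightarrow> I \<in> indep (contraction M G)"
    if I: "I \<subseteq> ground M - G" for I
  proof -
    have "I \<in> indep (contraction (contraction M F) (G - F)) \<longleftrightarrow> I \<union> D \<in> indep (contraction M F)"
      using I assms by (intro indep_contraction_basis D) (auto simp: ground_contraction)
    also have "\<dots> \<longleftrightarrow> I \<union> D \<union> B \<in> indep M"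
      using I assms DG by (intro indep_contraction_basis B) auto
    also have "\<dots> \<longleftrightarrow> I \<in> indep (contraction M G)"
      using indep_contraction_basis[OF DB I] by (simp add: Un_assoc)
    finally show ?thesis .
  qed
  moreover have "I \<subseteq> ground M - G" if "I \<in> indep (contraction (contraction M F) (G - F))" for I
    using indep_subset[OF that] unfolding gr by (simp add: ground_contraction)
  moreover have "I \<subseteq> ground M - G" if "I \<in> indep (contraction M G)" for I
    using indep_subset[OF that] by (simp add: ground_contraction)
  ultimately show "indep (contraction (contraction M F) (G - F)) = indep (contraction M G)"
    by blast
qed

lemma sum_flats_contraction:
  assumes "F \<in> flats M"
  shows "(\<Sum>G\<in>flats (contraction M F). f G) = (\<Sum>G | G \<in> flats M \<and> F \<subseteq> G. f (G - F))"
proof -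
  have "inj_on (\<lambda>G. G - F) {G \<in> flats M. F \<subseteq> G}" by (rule inj_onI) blast
  then show ?thesis by (simp add: flats_contraction[OF assms] sum.reindex)
qed

section \<open>The coefficients of the Kazhdan--Lusztig polynomial\<close>

text \<open>This is palindromicity solved for the coefficient of degree \<open>i\<close>; it
  terminates because \<open>j < i\<close>. Starting from the solved form turns the existence of the
  Kazhdan--Lusztig polynomials into a verification. The last branch is the degree bound.\<close>

fun kl_coeff :: "'a matroid \<Rightarrow> nat \<Rightarrow> int" where
  "kl_coeff M i =
     (if i = 0 then 1
      else if 2 * i < rk M then
        (\<Sum>j<i. (\<Sum>F | F \<in> flats M \<and> crk M F = i + j. kl_coeff (contraction M F) j)
              - (\<Sum>F | F \<in> flats M \<and> crk M F = rk M - i + j. kl_coeff (contraction M F) j))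
      else 0)"

declare kl_coeff.simps [simp del]

definition kl_poly :: "'a matroid \<Rightarrow> int poly" where
  "kl_poly M = (\<Sum>i\<le>rk M. monom (kl_coeff M i) i)"

lemma kl_coeff_0 [simp]: "kl_coeff M 0 = 1"
  by (simp add: kl_coeff.simps)

lemma kl_coeff_eq_0: "i > 0 \<Longrightarrow> rk M \<le> 2 * i \<Longrightarrow> kl_coeff M i = 0"
  by (subst kl_coeff.simps) simp

lemma coeff_kl_poly: "coeff (kl_poly M) i = kl_coeff M i"
  by (auto simp: kl_poly_def coeff_sum intro: kl_coeff_eq_0)

text \<open>If the degree were at least half of the positive rank, the leading coefficient would
  vanish; the polynomial would then be 0, of degree 0, which is too small.\<close>

lemma degree_kl_poly: "rk M > 0 \<Longrightarrow> 2 * degree (kl_poly M) < rk M"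
proof (rule ccontr)
  assume *: "rk M > 0" "\<not> 2 * degree (kl_poly M) < rk M"
  then have "coeff (kl_poly M) (degree (kl_poly M)) = 0"
    by (simp add: coeff_kl_poly kl_coeff_eq_0)
  then have "kl_poly M = 0" by simp
  then show False using * by simp
qed

lemma kl_poly_rk_0: "rk M = 0 \<Longrightarrow> kl_poly M = 1"
  by (simp add: kl_poly_def)

lemma degree_kl_poly_le: "degree (kl_poly M) \<le> rk M"
  using degree_kl_poly[of M] kl_poly_rk_0[of M] by (cases "rk M = 0") auto

lemma rk_contraction_min_flat: "rk (contraction M (min_flat M)) = rk M"
  by (simp add: rk_contraction min_flat_in_flats crk_eq rank_of_min_flat)

text \<open>Contracting the loops changes neither the coranks of flats nor the contractions by them,
  so one unfolding of the recursion matches both sides and no induction is required.\<close>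

lemma kl_coeff_contraction_min_flat: "kl_coeff (contraction M (min_flat M)) i = kl_coeff M i"
proof -
  let ?Z = "min_flat M"
  have "(\<Sum>F | F \<in> flats (contraction M ?Z) \<and> crk (contraction M ?Z) F = k.
            kl_coeff (contraction (contraction M ?Z) F) j)
      = (\<Sum>F | F \<in> flats M \<and> crk M F = k. kl_coeff (contraction M F) j)" for k j
  proof -
    have "(\<Sum>F | F \<in> flats (contraction M ?Z) \<and> crk (contraction M ?Z) F = k.
            kl_coeff (contraction (contraction M ?Z) F) j)
        = (\<Sum>F\<in>flats (contraction M ?Z). if crk (contraction M ?Z) F = k
            then kl_coeff (contraction (contraction M ?Z) F) j else 0)"
      by (rule sum.inter_filter) (rule finite_flats)
    also have "\<dots> = (\<Sum>F | F \<in> flats M \<and> ?Z \<subseteq> F. if crk M F = k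
            then kl_coeff (contraction M F) j else 0)"
      unfolding sum_flats_contraction[OF min_flat_in_flats]
      by (intro sum.cong)
        (auto simp: crk_contraction min_flat_in_flats contraction_contraction flat_subset_ground)
    also have "{F \<in> flats M. ?Z \<subseteq> F} = flats M" by (auto dest: min_flat_subset)
    also have "(\<Sum>F\<in>flats M. if crk M F = k then kl_coeff (contraction M F) j else 0)
        = (\<Sum>F | F \<in> flats M \<and> crk M F = k. kl_coeff (contraction M F) j)"
      by (rule sum.inter_filter[symmetric]) (rule finite_flats)
    finally show ?thesis .
  qed
  then show ?thesis
    by (subst (1 2) kl_coeff.simps) (simp add: rk_contraction_min_flat)
qed

lemma kl_poly_contraction_min_flat: "kl_poly (contraction M (min_flat M)) = kl_poly M"
  by (simp add: kl_poly_def rk_contraction_min_flat kl_coeff_contraction_min_flat)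

text \<open>The degree bound keeps \<open>n - i\<close> from truncating, so at most the index
  \<open>i = n - k\<close> contributes in degree \<open>k\<close>.\<close>

lemma coeff_rev_poly:
  assumes "degree p \<le> n"
  shows "coeff (rev_poly n p) k = (if k \<le> n then coeff p (n - k) else 0)"
proof -
  have "coeff (rev_poly n p) k = (\<Sum>i\<le>degree p. if i = n - k \<and> k \<le> n then coeff p i else 0)"
    using assms by (auto simp: rev_poly_def coeff_sum intro!: sum.cong)
  also have "\<dots> = (if k \<le> n then coeff p (n - k) else 0)"
    by (cases "k \<le> n") (auto simp: sum.delta' coeff_eq_0)
  finally show ?thesis .
qed

section \<open>Palindromicity of the Z-polynomial\<close>

text \<open>Flats are grouped by \<open>j = crk M F - k\<close>. Those with
  \<open>crk M F \<ge> 2 * k\<close> drop out: the contraction has rank \<open>crk M F\<close>,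
  which is at most twice the requested degree.\<close>

lemma sum_kl_coeff_low:
  assumes "k > 0"
  shows "(\<Sum>F | F \<in> flats M \<and> k \<le> crk M F. kl_coeff (contraction M F) (crk M F - k))
       = (\<Sum>j<k. \<Sum>F | F \<in> flats M \<and> crk M F = k + j. kl_coeff (contraction M F) j)"
proof -
  let ?g = "\<lambda>F. kl_coeff (contraction M F) (crk M F - k)"
  have "(\<Sum>F | F \<in> flats M \<and> k \<le> crk M F. ?g F)
      = (\<Sum>F | F \<in> flats M \<and> k \<le> crk M F \<and> crk M F < 2 * k. ?g F)"
    using assms
    by (intro sum.mono_neutral_right) (auto simp: finite_flats rk_contraction intro!: kl_coeff_eq_0)
  also have "\<dots> = (\<Sum>j<k. \<Sum>F | F \<in> {F \<in> flats M. k \<le> crk M F \<and> crk M F < 2 * k} \<and> crk M F - k = j. ?g F)"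
    by (intro sum.group[symmetric]) (auto simp: finite_flats)
  also have "\<dots> = (\<Sum>j<k. \<Sum>F | F \<in> flats M \<and> crk M F = k + j. kl_coeff (contraction M F) j)"
    by (intro sum.cong) auto
  finally show ?thesis .
qed

text \<open>Grouping as before, \<open>j\<close> now runs up to \<open>k\<close>. The top value
  \<open>j = k\<close> contributes \<open>kl_coeff M k\<close>, the unknown for which the recursion
  is solved.\<close>

lemma sum_kl_coeff_high:
  assumes "k \<le> rk M"
  shows "(\<Sum>F | F \<in> flats M \<and> rk M - k \<le> crk M F. kl_coeff (contraction M F) (crk M F - (rk M - k)))
       = (\<Sum>j<k. \<Sum>F | F \<in> flats M \<and> crk M F = rk M - k + j. kl_coeff (contraction M F) j)
         + kl_coeff M k"
proof -
  let ?g = "\<lambda>F. kl_coeff (contraction M F) (crk M F - (rk M - k))"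
  let ?A = "{F \<in> flats M. rk M - k \<le> crk M F}"
  have "(\<Sum>F\<in>?A. ?g F) = (\<Sum>j\<le>k. \<Sum>F | F \<in> ?A \<and> crk M F - (rk M - k) = j. ?g F)"
    using assms by (intro sum.group[symmetric]) (auto simp: finite_flats crk_eq)
  also have "\<dots> = (\<Sum>j\<le>k. \<Sum>F | F \<in> flats M \<and> crk M F = rk M - k + j. kl_coeff (contraction M F) j)"
    by (intro sum.cong) auto
  also have "\<dots> = (\<Sum>j<k. \<Sum>F | F \<in> flats M \<and> crk M F = rk M - k + j. kl_coeff (contraction M F) j)
       + (\<Sum>F | F \<in> flats M \<and> crk M F = rk M - k + k. kl_coeff (contraction M F) k)"
    by (simp flip: lessThan_Suc_atMost)
  \<comment> \<open>Full corank means rank 0, which only the minimal flat has.\<close>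
  also have "{F. F \<in> flats M \<and> crk M F = rk M - k + k} = {min_flat M}"
    using assms crk_add_rank_of[of _ M] rank_of_flat_eq_0_iff[of _ M] min_flat_in_flats[of M]
    by (auto simp: rank_of_min_flat) fastforce+
  finally show ?thesis by (simp add: kl_coeff_contraction_min_flat)
qed

text \<open>Below the middle degree this is the recursion of \<open>kl_coeff\<close> rearranged;
  symmetry gives the degrees above.\<close>

lemma sum_kl_coeff_palindromic:
  assumes "k \<le> rk M"
  shows "(\<Sum>F | F \<in> flats M \<and> rk M - k \<le> crk M F. kl_coeff (contraction M F) (crk M F - (rk M - k)))
       = (\<Sum>F | F \<in> flats M \<and> k \<le> crk M F. kl_coeff (contraction M F) (crk M F - k))"
proof -
  let ?V = "\<lambda>k. \<Sum>F | F \<in> flats M \<and> k \<le> crk M F. kl_coeff (contraction M F) (crk M F - k)"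
  have *: "?V (rk M - k) = ?V k" if k: "2 * k < rk M" for k
  proof (cases "k = 0")
    case True
    \<comment> \<open>For a flat of positive corank, the coefficient in the degree of the full rank
      of the contraction vanishes; only \<open>ground M\<close> survives.\<close>
    have "?V 0 = (\<Sum>F\<in>{ground M}. kl_coeff (contraction M F) (crk M F))"
      using crk_flat_eq_0_iff[of _ M]
      by (intro sum.mono_neutral_cong_right)
        (auto simp: finite_flats ground_in_flats rk_contraction intro!: kl_coeff_eq_0)
    also have "\<dots> = 1" using crk_flat_eq_0_iff[OF ground_in_flats, of M] by simp
    finally show ?thesis using sum_kl_coeff_high[of 0 M] True by simp
  next
    case False
    then have "kl_coeff M k = ?V k
        - (\<Sum>j<k. \<Sum>F | F \<in> flats M \<and> crk M F = rk M - k + j. kl_coeff (contraction M F) j)"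
      using k by (subst kl_coeff.simps, subst sum_kl_coeff_low) (simp_all add: sum_subtractf)
    then show ?thesis using sum_kl_coeff_high[of k M] k by simp
  qed
  \<comment> \<open>The claim is symmetric under exchanging \<open>k\<close> and
    \<open>rk M - k\<close>, and trivial in the middle degree.\<close>
  consider "2 * k < rk M" | "2 * (rk M - k) < rk M" | "rk M - k = k" using assms by linarith
  then show ?thesis
    using *[of k] *[of "rk M - k"] assms by cases auto
qed

text \<open>The left side is the Z-polynomial of \<open>M\<close>; the right side is its reversal in
  degree \<open>rk M\<close>, because \<open>t ^ rk M\<close> divided by
  \<open>t ^ rank_of M F\<close> is \<open>t ^ crk M F\<close>.\<close>

lemma Z_polynomial_palindromic:
  "(\<Sum>F\<in>flats M. monom 1 (rank_of M F) * kl_poly (contraction M F))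
     = (\<Sum>F\<in>flats M. rev_poly (crk M F) (kl_poly (contraction M F)))" (is "?L = ?R")
proof (rule poly_eqI)
  fix k
  have deg: "degree (kl_poly (contraction M F)) \<le> crk M F" if "F \<in> flats M" for F
    using degree_kl_poly_le[of "contraction M F"] that by (simp add: rk_contraction)
  have R: "coeff ?R k = (\<Sum>F | F \<in> flats M \<and> k \<le> crk M F. kl_coeff (contraction M F) (crk M F - k))"
    unfolding coeff_sum sum.inter_filter[OF finite_flats]
    by (intro sum.cong) (simp_all add: coeff_rev_poly deg coeff_kl_poly)
  have L: "coeff ?L k =
      (\<Sum>F\<in>flats M. if rank_of M F \<le> k then kl_coeff (contraction M F) (k - rank_of M F) else 0)"
    unfolding coeff_sum by (intro sum.cong) (simp_all add: coeff_monom_mult coeff_kl_poly)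
  show "coeff ?L k = coeff ?R k"
  proof (cases "k \<le> rk M")
    case True
    have "coeff ?L k =
        (\<Sum>F\<in>flats M. if rk M - k \<le> crk M F then kl_coeff (contraction M F) (crk M F - (rk M - k)) else 0)"
      unfolding L
    proof (rule sum.cong)
      fix F assume "F \<in> flats M"
      then have "crk M F + rank_of M F = rk M" by (rule crk_add_rank_of)
      then have "rank_of M F \<le> k \<longleftrightarrow> rk M - k \<le> crk M F"
        "rank_of M F \<le> k \<Longrightarrow> k - rank_of M F = crk M F - (rk M - k)" using True by linarith+
      then show "(if rank_of M F \<le> k then kl_coeff (contraction M F) (k - rank_of M F) else 0)
        = (if rk M - k \<le> crk M F then kl_coeff (contraction M F) (crk M F - (rk M - k)) else 0)"
        by auto
    qed simp
    then show ?thesis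
      using sum_kl_coeff_palindromic[OF True] R by (simp add: sum.inter_filter finite_flats)
  next
    case False
    \<comment> \<open>Here \<open>k - rank_of M F\<close> exceeds \<open>crk M F\<close>, the rank
      of the contraction.\<close>
    have "coeff ?L k = 0"
      unfolding L using False
      by (intro sum.neutral) (auto simp: rk_contraction crk_eq dest: rank_of_flat_le intro!: kl_coeff_eq_0)
    moreover have "coeff ?R k = 0"
      unfolding R using False by (intro sum.neutral) (auto simp: crk_eq)
    ultimately show ?thesis by simp
  qed
qed

section \<open>The Kazhdan--Lusztig assignment\<close>

text \<open>The recursion consults only members of the family strictly below \<open>Y\<close>. This
  identifies the Moebius function of a localization with that of \<open>M\<close>.\<close>

lemma mobius_cong:
  assumes "finite Y" "\<And>Z. Z \<subset> Y \<Longrightarrow> Z \<in> L \<longleftrightarrow> Z \<in> L'"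
  shows "mobius L X Y = mobius L' X Y"
  using assms
proof (induction "card Y" arbitrary: Y rule: less_induct)
  case less
  have "mobius L X Z = mobius L' X Z" if "Z \<subset> Y" for Z
    using less that by (intro less.hyps) (auto intro: psubset_card_mono finite_subset)
  then have "(\<Sum>Z | Z \<in> L \<and> X \<subseteq> Z \<and> Z \<subset> Y. mobius L X Z)
      = (\<Sum>Z | Z \<in> L' \<and> X \<subseteq> Z \<and> Z \<subset> Y. mobius L' X Z)"
    using less.prems by (intro sum.cong) auto
  then show ?case by (subst (1 2) mobius.simps) simp
qed

lemma sum_mobius_eq:
  assumes H: "H \<in> flats M"
  shows "(\<Sum>G | G \<in> flats M \<and> G \<subseteq> H. mobius (flats M) (min_flat M) G)
       = (if H = min_flat M then 1 else 0)"
proof (cases "H = min_flat M")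
  case True
  then have "{G \<in> flats M. G \<subseteq> H} = {min_flat M}"
    using H by (auto dest: min_flat_subset)
  then show ?thesis using True by (simp add: mobius.simps)
next
  case False
  have "finite H" using H by (rule finite_flat)
  have "{G \<in> flats M. G \<subseteq> H} = insert H {G \<in> flats M. min_flat M \<subseteq> G \<and> G \<subset> H}"
    using H by (auto dest: min_flat_subset)
  moreover have "mobius (flats M) (min_flat M) H
      = - (\<Sum>G | G \<in> flats M \<and> min_flat M \<subseteq> G \<and> G \<subset> H. mobius (flats M) (min_flat M) G)"
    using False \<open>finite H\<close> min_flat_subset[OF H] by (subst mobius.simps) auto
  ultimately show ?thesis using False by (simp add: finite_flats)
qed

lemma min_flat_localization:
  assumes "F \<in> flats M"
  shows "min_flat (localization M F) = min_flat M"
  using min_flat_in_flats[of M] min_flat_subset[OF assms]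
  by (auto simp: min_flat_def flats_localization[OF assms])

text \<open>Everything is expressed through the Moebius function and the ranks of \<open>M\<close>,
  which makes the double sum over pairs of flats in the kernel identity exchangeable.\<close>

lemma char_poly_localization:
  assumes F: "F \<in> flats M"
  shows "char_poly (localization M F)
       = (\<Sum>G | G \<in> flats M \<and> G \<subseteq> F.
            monom (mobius (flats M) (min_flat M) G) (rank_of M F - rank_of M G))"
  unfolding char_poly_def min_flat_localization[OF F] flats_localization[OF F]
proof (rule sum.cong)
  fix G assume G: "G \<in> {G \<in> flats M. G \<subseteq> F}"
  then have "finite G" using finite_flat by auto
  then have "mobius {G \<in> flats M. G \<subseteq> F} (min_flat M) G = mobius (flats M) (min_flat M) G"
    using G by (intro mobius_cong) auto
  then show "monom (mobius {G \<in> flats M. G \<subseteq> F} (min_flat M) G) (crk (localization M F) G)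
      = monom (mobius (flats M) (min_flat M) G) (rank_of M F - rank_of M G)"
    using G by (simp add: crk_eq rk_localization rank_of_localization)
qed simp

lemma smult_sum_right: "smult c (\<Sum>x\<in>A. f x) = (\<Sum>x\<in>A. smult c (f x))"
  by (induction A rule: infinite_finite_induct) (simp_all add: smult_add_right)

text \<open>Expanding the characteristic polynomials and exchanging the sums leaves, for each
  \<open>G\<close>, the Z-polynomial of the contraction by \<open>G\<close>. It is replaced by its
  reversal; after exchanging back, the Moebius sums vanish except at
  \<open>F = min_flat M\<close>.\<close>

lemma kl_poly_kernel:
  "rev_poly (rk M) (kl_poly M) =
     (\<Sum>F\<in>flats M. char_poly (localization M F) * kl_poly (contraction M F))"
proof -
  let ?L = "flats M"
  let ?m = "mobius ?L (min_flat M)"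
  let ?P = "\<lambda>F. kl_poly (contraction M F)"
  have swap: "(\<Sum>F\<in>?L. \<Sum>G | G \<in> ?L \<and> G \<subseteq> F. f F G) = (\<Sum>G\<in>?L. \<Sum>F | F \<in> ?L \<and> G \<subseteq> F. f F G)"
    for f :: "'a set \<Rightarrow> 'a set \<Rightarrow> int poly"
    by (rule sum.swap_restrict) (simp_all add: finite_flats)
  \<comment> \<open>Palindromicity of the contraction by \<open>G\<close>, pulled back along
    \<open>F \<mapsto> F - G\<close>.\<close>
  have Z: "(\<Sum>F | F \<in> ?L \<and> G \<subseteq> F. monom 1 (rank_of M F - rank_of M G) * ?P F)
      = (\<Sum>F | F \<in> ?L \<and> G \<subseteq> F. rev_poly (crk M F) (?P F))" if G: "G \<in> ?L" for G
  proof -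
    have "rank_of (contraction M G) (F - G) = rank_of M F - rank_of M G" if "F \<in> ?L" "G \<subseteq> F" for F
      using rank_of_contraction[of G F M] that flat_subset_ground[of F M] by simp
    then show ?thesis
      using Z_polynomial_palindromic[of "contraction M G"] G
      by (simp add: sum_flats_contraction contraction_contraction flat_subset_ground crk_contraction)
  qed
  have "(\<Sum>F\<in>?L. char_poly (localization M F) * ?P F)
      = (\<Sum>F\<in>?L. \<Sum>G | G \<in> ?L \<and> G \<subseteq> F. smult (?m G) (monom 1 (rank_of M F - rank_of M G) * ?P F))"
    by (intro sum.cong refl)
      (simp add: char_poly_localization sum_distrib_right smult_monom flip: mult_smult_left)
  also have "\<dots> = (\<Sum>G\<in>?L. smult (?m G)
      (\<Sum>F | F \<in> ?L \<and> G \<subseteq> F. monom 1 (rank_of M F - rank_of M G) * ?P F))"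
    by (simp add: swap smult_sum_right)
  also have "\<dots> = (\<Sum>G\<in>?L. smult (?m G) (\<Sum>F | F \<in> ?L \<and> G \<subseteq> F. rev_poly (crk M F) (?P F)))"
    by (intro sum.cong) (simp_all add: Z)
  also have "\<dots> = (\<Sum>F\<in>?L. \<Sum>G | G \<in> ?L \<and> G \<subseteq> F. smult (?m G) (rev_poly (crk M F) (?P F)))"
    by (simp add: swap smult_sum_right)
  also have "\<dots> = (\<Sum>F\<in>?L. smult (\<Sum>G | G \<in> ?L \<and> G \<subseteq> F. ?m G) (rev_poly (crk M F) (?P F)))"
    by (simp add: smult_sum)
  also have "\<dots> = (\<Sum>F\<in>?L. if F = min_flat M then rev_poly (crk M F) (?P F) else 0)"
    by (intro sum.cong) (simp_all add: sum_mobius_eq)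
  also have "\<dots> = rev_poly (rk M) (kl_poly M)"
    by (simp add: finite_flats min_flat_in_flats kl_poly_contraction_min_flat crk_eq rank_of_min_flat)
  finally show ?thesis by simp
qed

lemma is_KL_assignment_kl_poly: "is_KL_assignment kl_poly"
  by (simp add: is_KL_assignment_def kl_poly_rk_0 degree_kl_poly kl_poly_kernel)

section \<open>Uniqueness of the Kazhdan--Lusztig assignment\<close>

text \<open>By induction on the rank, only the term of the minimal flat can differ. Its contraction
  is \<open>M\<close> with the loops removed, which need not be \<open>M\<close> and has the same
  rank, so the loopless matroid is settled first and \<open>M\<close> afterwards.\<close>

lemma is_KL_assignment_unique:
  assumes P: "is_KL_assignment P" and Q: "is_KL_assignment Q"
  shows "P M = Q M"
proof (induction "rk M" arbitrary: M rule: less_induct)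
  case less
  show ?case
  proof (cases "rk M = 0")
    case True
    then show ?thesis using P Q by (simp add: is_KL_assignment_def)
  next
    case False
    have deg: "2 * degree (P N) < rk N" "2 * degree (Q N) < rk N" if "rk N = rk M" for N
      using P Q False that unfolding is_KL_assignment_def by (metis neq0_conv)+
    \<comment> \<open>All other flats have positive rank, hence contractions of smaller rank; the
      localization at the minimal flat has characteristic polynomial 1.\<close>
    have diff: "rev_poly (rk N) (P N) - rev_poly (rk N) (Q N)
        = P (contraction N (min_flat N)) - Q (contraction N (min_flat N))" if N: "rk N = rk M" for N
    proof -
      have "P (contraction N F) = Q (contraction N F)" if "F \<in> flats N - {min_flat N}" for F
      proof (rule less.hyps)
        have "rank_of N F > 0" using rank_of_flat_eq_0_iff[of F N] that by auto
        then show "rk (contraction N F) < rk M"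
          using that N crk_add_rank_of[of F N] by (simp add: rk_contraction)
      qed
      then have "(\<Sum>F\<in>flats N - {min_flat N}. char_poly (localization N F) * P (contraction N F))
          = (\<Sum>F\<in>flats N - {min_flat N}. char_poly (localization N F) * Q (contraction N F))"
        by simp
      moreover have "char_poly (localization N (min_flat N)) = 1"
      proof -
        have "{G \<in> flats N. G \<subseteq> min_flat N} = {min_flat N}"
          using min_flat_in_flats by (auto dest: min_flat_subset)
        then show ?thesis
          by (simp add: char_poly_localization min_flat_in_flats mobius.simps)
      qed
      moreover have "rev_poly (rk N) (R N) = char_poly (localization N (min_flat N)) * R (contraction N (min_flat N))
          + (\<Sum>F\<in>flats N - {min_flat N}. char_poly (localization N F) * R (contraction N F))"
        if "is_KL_assignment R" for R
        using that sum.remove[OF finite_flats min_flat_in_flats, of "\<lambda>F. char_poly (localization N F) * R (contraction N F)"]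
        by (simp add: is_KL_assignment_def)
      ultimately show ?thesis using P Q by simp
    qed
    \<comment> \<open>\<open>?N\<close> has no loops, so contracting its minimal flat returns
      \<open>?N\<close> and the equation \<open>diff\<close> closes up on \<open>?N\<close>.\<close>
    let ?N = "contraction M (min_flat M)"
    have rkN: "rk ?N = rk M" by (rule rk_contraction_min_flat)
    have "min_flat ?N = min_flat M - min_flat M"
    proof -
      have "{} \<in> flats ?N"
        using min_flat_in_flats[of M] by (auto simp: flats_contraction)
      then show ?thesis by (auto simp: min_flat_def)
    qed
    then have "contraction ?N (min_flat ?N) = ?N"
      using contraction_contraction[of "min_flat M" "min_flat M" M]
      by (simp add: flat_subset_ground min_flat_in_flats)
    then have N: "rev_poly (rk M) (P ?N) - rev_poly (rk M) (Q ?N) = P ?N - Q ?N"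
      using diff[OF rkN] rkN by simp
    \<comment> \<open>The difference \<open>P ?N - Q ?N\<close> equals its own reversal. Its degree
      is below half the rank, so reversal moves each possible nonzero coefficient to a degree where
      the difference vanishes.\<close>
    have "coeff (P ?N) i = coeff (Q ?N) i" for i
    proof (cases "2 * i < rk M")
      case True
      then have "coeff (P ?N) (rk M - i) = 0" "coeff (Q ?N) (rk M - i) = 0"
        using deg[OF rkN] rkN by (auto intro!: coeff_eq_0)
      then show ?thesis
        using arg_cong[OF N, of "\<lambda>p. coeff p (rk M - i)"] deg[OF rkN] rkN True
        by (simp add: coeff_rev_poly)
    next
      case False
      then show ?thesis using deg[OF rkN] rkN by (simp add: coeff_eq_0)
    qed
    then have "P ?N = Q ?N" by (rule poly_eqI)
    \<comment> \<open>With agreement on \<open>?N\<close>, the right side of \<open>diff\<close> for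
      \<open>M\<close> is 0; reversal in a fixed degree is injective.\<close>
    then have rev: "rev_poly (rk M) (P M) = rev_poly (rk M) (Q M)"
      using diff[of M] by simp
    have "coeff (P M) i = coeff (Q M) i" for i
    proof (cases "i \<le> rk M")
      case True
      then show ?thesis
        using arg_cong[OF rev, of "\<lambda>p. coeff p (rk M - i)"] deg[of M] by (simp add: coeff_rev_poly)
    next
      case False
      then show ?thesis using deg[of M] by (simp add: coeff_eq_0)
    qed
    then show ?thesis by (rule poly_eqI)
  qed
qed

lemma KL_poly_eq_kl_poly: "KL_poly = kl_poly"
  unfolding KL_poly_def
  using is_KL_assignment_kl_poly is_KL_assignment_unique by (intro the_equality ext) auto

section \<open>Solving the recursion by Whitney numbers\<close>

lemma whitney_cong: "(\<And>j. j \<in> {1..r} \<Longrightarrow> w j = w' j) \<Longrightarrow> whitney M r w = whitney M r w'"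
  unfolding whitney_def by (rule arg_cong[where f = card]) auto

lemma whitney_0: "whitney M 0 w = 1"
  by (simp add: whitney_def)

text \<open>The chains are sorted by their smallest member \<open>F\<close>, which carries the
  largest index \<open>Suc r\<close>. Removing \<open>F\<close> from the other members gives a chain
  of flats of the contraction with the same coranks.\<close>

lemma whitney_Suc:
  "whitney M (Suc r) w =
     (\<Sum>F | F \<in> flats M \<and> int (crk M F) = w (Suc r). whitney (contraction M F) r w)"
proof -
  define C where "C N s = {F \<in> {1..s} \<rightarrow>\<^sub>E flats N.
             (\<forall>j\<in>{1..<s}. F (j + 1) \<subseteq> F j) \<and> (\<forall>j\<in>{1..s}. int (crk N (F j)) = w j)}"
    for N :: "'a matroid" and s
  define A where "A = {F \<in> flats M. int (crk M F) = w (Suc r)}"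
  have fin: "finite (C M (Suc r))"
    unfolding C_def by (rule finite_subset[of _ "{1..Suc r} \<rightarrow>\<^sub>E flats M"])
      (auto intro!: finite_PiE simp: finite_flats)
  have "card {f \<in> C M (Suc r). f (Suc r) = F} = card (C (contraction M F) r)" if F: "F \<in> A" for F
  proof (rule bij_betw_same_card)
    have FM: "F \<in> flats M" using F by (simp add: A_def)
    show "bij_betw (\<lambda>f. \<lambda>j\<in>{1..r}. f j - F) {f \<in> C M (Suc r). f (Suc r) = F} (C (contraction M F) r)"
    proof (rule bij_betw_byWitness[where f' = "\<lambda>g. (\<lambda>j\<in>{1..Suc r}. if j = Suc r then F else g j \<union> F)"])
      \<comment> \<open>Members shrink as the index grows, so the induction descends from
        \<open>Suc r\<close>.\<close>
      have sub: "F \<subseteq> f j" if f: "f \<in> C M (Suc r)" "f (Suc r) = F" and j: "j \<in> {1..Suc r}" for f j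
      proof -
        have "j \<le> Suc r" using j by simp
        then show ?thesis using j
        proof (induction rule: inc_induct)
          case base
          then show ?case using f by simp
        next
          case (step n)
          then have "f (n + 1) \<subseteq> f n" using f(1) by (auto simp: C_def)
          then show ?case using step by auto
        qed
      qed
      show "\<forall>f\<in>{f \<in> C M (Suc r). f (Suc r) = F}.
          (\<lambda>j\<in>{1..Suc r}. if j = Suc r then F else (\<lambda>j\<in>{1..r}. f j - F) j \<union> F) = f"
      proof (intro ballI ext)
        fix f j assume f: "f \<in> {f \<in> C M (Suc r). f (Suc r) = F}"
        show "(\<lambda>j\<in>{1..Suc r}. if j = Suc r then F else (\<lambda>j\<in>{1..r}. f j - F) j \<union> F) j = f j"
        proof (cases "j \<in> {1..Suc r}")
          case True
          then show ?thesis using sub[of f j] f by auto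
        next
          case False
          \<comment> \<open>Outside the index range both functions are
            \<open>undefined\<close>.\<close>
          then show ?thesis using f unfolding C_def by (auto simp: PiE_def extensional_def)
        qed
      qed
      show "\<forall>g\<in>C (contraction M F) r.
          (\<lambda>j\<in>{1..r}. (\<lambda>j\<in>{1..Suc r}. if j = Suc r then F else g j \<union> F) j - F) = g"
      proof (intro ballI ext)
        fix g j assume g: "g \<in> C (contraction M F) r"
        show "(\<lambda>j\<in>{1..r}. (\<lambda>j\<in>{1..Suc r}. if j = Suc r then F else g j \<union> F) j - F) j = g j"
        proof (cases "j \<in> {1..r}")
          case True
          then have "g j \<in> flats (contraction M F)" using g by (auto simp: C_def)
          then have "g j \<inter> F = {}" using FM by (auto simp: flats_contraction)
          then show ?thesis using True by auto
        next
          case False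
          then show ?thesis using g unfolding C_def by (auto simp: PiE_def extensional_def)
        qed
      qed
      show "(\<lambda>f. \<lambda>j\<in>{1..r}. f j - F) ` {f \<in> C M (Suc r). f (Suc r) = F} \<subseteq> C (contraction M F) r"
      proof (intro image_subsetI)
        fix f assume "f \<in> {f \<in> C M (Suc r). f (Suc r) = F}"
        then have f: "f \<in> C M (Suc r)" "f (Suc r) = F" by auto
        have 1: "f j \<in> flats M" "F \<subseteq> f j" "int (crk M (f j)) = w j" if "j \<in> {1..r}" for j
          using f sub[OF f, of j] that by (auto simp: C_def)
        have 2: "f (j + 1) \<subseteq> f j" if "j \<in> {1..<r}" for j using f that by (auto simp: C_def)
        show "(\<lambda>j\<in>{1..r}. f j - F) \<in> C (contraction M F) r"
          unfolding C_def
        proof (intro CollectI conjI ballI)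
          show "(\<lambda>j\<in>{1..r}. f j - F) \<in> {1..r} \<rightarrow>\<^sub>E flats (contraction M F)"
            using 1 by (auto simp: flats_contraction[OF FM])
        next
          fix j assume "j \<in> {1..<r}"
          then show "(\<lambda>j\<in>{1..r}. f j - F) (j + 1) \<subseteq> (\<lambda>j\<in>{1..r}. f j - F) j"
            using 2[of j] by auto
        next
          fix j assume "j \<in> {1..r}"
          then show "int (crk (contraction M F) ((\<lambda>j\<in>{1..r}. f j - F) j)) = w j"
            using 1[of j] by (simp add: crk_contraction[OF FM])
        qed
      qed
      show "(\<lambda>g. \<lambda>j\<in>{1..Suc r}. if j = Suc r then F else g j \<union> F) ` C (contraction M F) r
          \<subseteq> {f \<in> C M (Suc r). f (Suc r) = F}"
      proof (intro image_subsetI)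
        fix g assume g: "g \<in> C (contraction M F) r"
        have 1: "g j \<union> F \<in> flats M \<and> int (crk M (g j \<union> F)) = w j" if "j \<in> {1..r}" for j
        proof -
          have gj: "g j \<in> flats (contraction M F)" "int (crk (contraction M F) (g j)) = w j"
            using g that by (auto simp: C_def)
          then obtain G where G: "G \<in> flats M" "F \<subseteq> G" "g j = G - F"
            using FM by (auto simp: flats_contraction)
          then have "g j \<union> F = G" by auto
          then show ?thesis using G gj crk_contraction[OF FM, of G] by simp
        qed
        have 2: "g (j + 1) \<subseteq> g j" if "j \<in> {1..<r}" for j using g that by (auto simp: C_def)
        let ?f = "\<lambda>j\<in>{1..Suc r}. if j = Suc r then F else g j \<union> F"
        have "?f \<in> C M (Suc r)"
          unfolding C_def
        proof (intro CollectI conjI ballI)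
          show "?f \<in> {1..Suc r} \<rightarrow>\<^sub>E flats M"
          proof
            fix j assume "j \<in> {1..Suc r}"
            then show "?f j \<in> flats M" using 1[of j] FM by auto
          qed auto
        next
          fix j assume "j \<in> {1..<Suc r}"
          then show "?f (j + 1) \<subseteq> ?f j" using 2[of j] by (cases "j = r") auto
        next
          fix j assume "j \<in> {1..Suc r}"
          then show "int (crk M (?f j)) = w j" using 1[of j] F by (auto simp: A_def)
        qed
        then show "?f \<in> {f \<in> C M (Suc r). f (Suc r) = F}" by simp
      qed
    qed
  qed
  moreover have "card (C M (Suc r)) = (\<Sum>F\<in>A. card {f \<in> C M (Suc r). f (Suc r) = F})"
  proof -
    have "(\<lambda>f. f (Suc r)) ` C M (Suc r) \<subseteq> A" by (auto simp: C_def A_def)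
    moreover have "finite A" by (simp add: A_def finite_flats)
    ultimately have "(\<Sum>F\<in>A. \<Sum>f | f \<in> C M (Suc r) \<and> f (Suc r) = F. 1) = (\<Sum>f\<in>C M (Suc r). 1::nat)"
      by (intro sum.group fin)
    then show ?thesis by simp
  qed
  moreover have "whitney M (Suc r) w = card (C M (Suc r))"
    "\<And>F. whitney (contraction M F) r w = card (C (contraction M F) r)"
    unfolding whitney_def C_def by simp_all
  ultimately show ?thesis by (simp add: A_def)
qed

section \<open>The next index outside a set\<close>

lemma next_notin_le: "S \<subseteq> {1..r} \<Longrightarrow> j \<le> Suc r \<Longrightarrow> next_notin S j \<le> Suc r"
  unfolding next_notin_def by (rule Least_le) auto

lemma next_notin_self: "j \<notin> S \<Longrightarrow> next_notin S j = j"
  unfolding next_notin_def by (rule Least_equality) auto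

lemma next_notin_insert_Suc:
  assumes S: "S \<subseteq> {1..r}" and j: "j \<le> Suc r"
  shows "next_notin (insert (Suc r) S) j =
    (if next_notin S j = Suc r then Suc (Suc r) else next_notin S j)"
proof -
  let ?n = "next_notin S j"
  have n: "j \<le> ?n" "?n \<notin> S"
  proof -
    have "j \<le> Suc r \<and> Suc r \<notin> S" using S j by auto
    from LeastI[of "\<lambda>k. k \<ge> j \<and> k \<notin> S", OF this] show "j \<le> ?n" "?n \<notin> S"
      by (simp_all add: next_notin_def)
  qed
  have least: "?n \<le> k" if "k \<ge> j" "k \<notin> S" for k
    unfolding next_notin_def using that by (intro Least_le) auto
  show ?thesis
  proof (cases "?n = Suc r")
    case True
    have "(LEAST k. k \<ge> j \<and> k \<notin> insert (Suc r) S) = Suc (Suc r)"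
    proof (rule Least_equality)
      show "Suc (Suc r) \<ge> j \<and> Suc (Suc r) \<notin> insert (Suc r) S" using S j by auto
      fix k assume "k \<ge> j \<and> k \<notin> insert (Suc r) S"
      then show "Suc (Suc r) \<le> k" using least[of k] True by auto
    qed
    then show ?thesis using True by (simp add: next_notin_def)
  next
    case False
    have "(LEAST k. k \<ge> j \<and> k \<notin> insert (Suc r) S) = ?n"
      using n False least by (intro Least_equality) auto
    then show ?thesis using False by (simp add: next_notin_def)
  qed
qed

section \<open>Strictly increasing index sequences\<close>

text \<open>These are the sequences of \<open>index_seqs\<close> without their last entry, which is
  the only one depending on the rank.\<close>

definition chain_seqs :: "nat \<Rightarrow> nat \<Rightarrow> (nat \<Rightarrow> int) set" where
  "chain_seqs i r = {b \<in> {0..r} \<rightarrow>\<^sub>E UNIV. strict_mono_on {0..r} b \<and> b 0 = 0 \<and> b r = int i}"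

lemma strict_mono_on_atMost_Suc:
  fixes f :: "nat \<Rightarrow> int"
  shows "strict_mono_on {0..Suc r} f \<longleftrightarrow> strict_mono_on {0..r} f \<and> f r < f (Suc r)"
proof
  assume f: "strict_mono_on {0..r} f \<and> f r < f (Suc r)"
  show "strict_mono_on {0..Suc r} f"
  proof (rule strict_mono_onI)
    fix x y assume xy: "x \<in> {0..Suc r}" "y \<in> {0..Suc r}" "x < y"
    show "f x < f y"
    proof (cases "y = Suc r")
      case True
      have "f x \<le> f r" using f xy by (intro strict_mono_on_leD[of "{0..r}" f]) auto
      then show ?thesis using f True by simp
    next
      case False
      then show ?thesis using f xy by (auto intro: strict_mono_onD)
    qed
  qed
qed (auto simp: strict_mono_on_def)

lemma strict_mono_on_upd:
  fixes f :: "nat \<Rightarrow> int"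
  shows "strict_mono_on {0..r} (f(Suc r := e)) \<longleftrightarrow> strict_mono_on {0..r} f"
  by (auto simp: strict_mono_on_def)

lemma chain_seqs_0: "chain_seqs i 0 = (if i = 0 then {\<lambda>j\<in>{0}. 0} else {})"
  by (auto simp: chain_seqs_def strict_mono_on_def PiE_def extensional_def)

lemma chain_seqs_Suc:
  "chain_seqs i (Suc r) = (\<Union>j<i. (\<lambda>b. b(Suc r := int i)) ` chain_seqs j r)"
proof (intro equalityI subsetI)
  fix a assume a: "a \<in> chain_seqs i (Suc r)"
  \<comment> \<open>Resetting the last entry to \<open>undefined\<close> makes \<open>b\<close>
    extensional on \<open>{0..r}\<close>.\<close>
  define b where "b = a(Suc r := undefined)"
  have sm: "strict_mono_on {0..r} a" "a r < a (Suc r)" "a 0 = 0" "a (Suc r) = int i"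
    using a by (auto simp: chain_seqs_def strict_mono_on_atMost_Suc)
  \<comment> \<open>The entry \<open>a r\<close> is nonnegative, so \<open>nat (a r)\<close> loses
    nothing.\<close>
  have "a 0 \<le> a r" by (rule strict_mono_on_leD[OF sm(1)]) auto
  then have "int (nat (a r)) = a r" "nat (a r) < i" using sm by auto
  moreover from this have "b \<in> chain_seqs (nat (a r)) r"
    using a sm by (auto simp: chain_seqs_def b_def strict_mono_on_upd PiE_def extensional_def)
  moreover have "a = b(Suc r := int i)" using sm by (simp add: b_def fun_eq_iff)
  ultimately show "a \<in> (\<Union>j<i. (\<lambda>b. b(Suc r := int i)) ` chain_seqs j r)" by blast
next
  fix a assume "a \<in> (\<Union>j<i. (\<lambda>b. b(Suc r := int i)) ` chain_seqs j r)"
  then obtain j b where "j < i" "b \<in> chain_seqs j r" "a = b(Suc r := int i)" by auto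
  then show "a \<in> chain_seqs i (Suc r)"
    by (auto simp: chain_seqs_def strict_mono_on_atMost_Suc strict_mono_on_upd PiE_def extensional_def)
qed

lemma inj_on_chain_seqs_upd: "inj_on (\<lambda>b. b(Suc r := x)) (chain_seqs i r)"
proof (rule inj_onI)
  fix b c assume bc: "b \<in> chain_seqs i r" "c \<in> chain_seqs i r" "b(Suc r := x) = c(Suc r := x)"
  show "b = c"
  proof
    fix k
    show "b k = c k"
      using fun_cong[OF bc(3), of k] bc(1,2)
      by (cases "k = Suc r") (auto simp: chain_seqs_def PiE_def extensional_def)
  qed
qed

lemma finite_chain_seqs: "finite (chain_seqs i r)"
  by (induction r arbitrary: i) (auto simp: chain_seqs_0 chain_seqs_Suc)

lemma chain_seqs_empty: "i < r \<Longrightarrow> chain_seqs i r = {}"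
  by (induction r arbitrary: i) (auto simp: chain_seqs_Suc)

lemma sum_chain_seqs_Suc:
  "(\<Sum>b\<in>chain_seqs i (Suc r). f b) = (\<Sum>j<i. \<Sum>b\<in>chain_seqs j r. f (b(Suc r := int i)))"
proof -
  have "(\<lambda>b. b(Suc r := int i)) ` chain_seqs j r \<inter> (\<lambda>b. b(Suc r := int i)) ` chain_seqs k r = {}"
    if "j \<noteq> k" for j k
  proof -
    \<comment> \<open>The entry at \<open>r\<close> survives the update and tells the images
      apart.\<close>
    have "b r = int j" if "b \<in> (\<lambda>b. b(Suc r := int i)) ` chain_seqs j r" for b j
      using that by (auto simp: chain_seqs_def)
    then show ?thesis using that by (metis disjoint_iff of_nat_eq_iff)
  qed
  then have "(\<Sum>b\<in>chain_seqs i (Suc r). f b)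
      = (\<Sum>j<i. \<Sum>b\<in>(\<lambda>b. b(Suc r := int i)) ` chain_seqs j r. f b)"
    unfolding chain_seqs_Suc by (intro sum.UNION_disjoint) (auto simp: finite_chain_seqs)
  then show ?thesis by (simp add: sum.reindex inj_on_chain_seqs_upd)
qed

text \<open>The last inequality \<open>i < d - i\<close> amounts to \<open>2 * i < d\<close>,
  exactly the range in which the degree bound permits a nonzero coefficient.\<close>

lemma index_seqs_eq:
  "index_seqs d i r =
     (if 2 * i < d then (\<lambda>b. b(Suc r := int d - int i)) ` chain_seqs i r else {})"
proof -
  have "a \<in> (\<lambda>b. b(Suc r := int d - int i)) ` chain_seqs i r" if a: "a \<in> index_seqs d i r" for a
  proof
    show "a = (a(Suc r := undefined))(Suc r := int d - int i)"
      using a by (auto simp: index_seqs_def)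
    show "a(Suc r := undefined) \<in> chain_seqs i r"
      using a by (auto simp: index_seqs_def chain_seqs_def strict_mono_on_atMost_Suc
          strict_mono_on_upd PiE_def extensional_def)
  qed
  moreover have "2 * i < d" if "a \<in> index_seqs d i r" for a
    using that by (auto simp: index_seqs_def strict_mono_on_atMost_Suc)
  moreover have "b(Suc r := int d - int i) \<in> index_seqs d i r"
    if "b \<in> chain_seqs i r" "2 * i < d" for b
    using that by (auto simp: index_seqs_def chain_seqs_def strict_mono_on_atMost_Suc
          strict_mono_on_upd PiE_def extensional_def)
  ultimately show ?thesis by auto
qed

text \<open>
  Here \<open>e\<close> plays the role of \<open>a\<^sub>r\<^sub>+\<^sub>1\<close>; decoupling it from \<open>rk M - i\<close> makes the sum satisfy a
  recursion in \<open>r\<close>.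
\<close>
definition whitney_sum :: "'a matroid \<Rightarrow> nat \<Rightarrow> nat \<Rightarrow> nat \<Rightarrow> int" where
  "whitney_sum M r i e =
     (\<Sum>S\<in>Pow {1..r}. (-1) ^ card S *
       (\<Sum>b\<in>chain_seqs i r.
          int (whitney M r (\<lambda>j. (b(Suc r := int e)) (next_notin S j) + b (j - 1)))))"

lemma whitney_sum_0: "whitney_sum M 0 i e = (if i = 0 then 1 else 0)"
  by (simp add: whitney_sum_def chain_seqs_0 whitney_0)

lemma whitney_sum_eq_0: "i < r \<Longrightarrow> whitney_sum M r i e = 0"
  by (simp add: whitney_sum_def chain_seqs_empty)

section \<open>The recursion for the signed Whitney sums\<close>

text \<open>Common core of the cases \<open>Suc r \<notin> S\<close> and
  \<open>Suc r \<in> S\<close>. The number \<open>x\<close>, which is \<open>i\<close> or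
  \<open>e\<close>, is the entry read for the smallest flat, whose corank is then
  \<open>x + k\<close>; in the contraction, \<open>x\<close> becomes the new last entry.\<close>

lemma sum_whitney_chain_Suc:
  assumes next_r: "next_notin S (Suc r) = n"
    and step: "\<And>b j. b \<in> chain_seqs k r \<Longrightarrow> j \<in> {1..r} \<Longrightarrow>
      (b(Suc r := int i, Suc (Suc r) := int e)) (next_notin S j) = (b(Suc r := int x)) (next_notin S' j)"
    and last: "\<And>b. b \<in> chain_seqs k r \<Longrightarrow> (b(Suc r := int i, Suc (Suc r) := int e)) n = int x"
  shows "(\<Sum>b\<in>chain_seqs k r. int (whitney M (Suc r)
            (\<lambda>j. (b(Suc r := int i, Suc (Suc r) := int e)) (next_notin S j) + (b(Suc r := int i)) (j - 1))))
       = (\<Sum>F | F \<in> flats M \<and> crk M F = x + k. \<Sum>b\<in>chain_seqs k r.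
            int (whitney (contraction M F) r (\<lambda>j. (b(Suc r := int x)) (next_notin S' j) + b (j - 1))))"
proof -
  have "int (whitney M (Suc r)
            (\<lambda>j. (b(Suc r := int i, Suc (Suc r) := int e)) (next_notin S j) + (b(Suc r := int i)) (j - 1)))
       = (\<Sum>F | F \<in> flats M \<and> crk M F = x + k.
            int (whitney (contraction M F) r (\<lambda>j. (b(Suc r := int x)) (next_notin S' j) + b (j - 1))))"
    (is "int (whitney M (Suc r) ?w) = (\<Sum>F | _. int (whitney _ r ?w'))")
    if b: "b \<in> chain_seqs k r" for b
  proof -
    have "?w (Suc r) = int (x + k)"
      using b last[OF b] by (simp add: next_r chain_seqs_def del: fun_upd_apply) (simp add: chain_seqs_def)
    then have "{F. F \<in> flats M \<and> int (crk M F) = ?w (Suc r)} = {F. F \<in> flats M \<and> crk M F = x + k}"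
      by (simp only: of_nat_eq_iff)
    moreover have "whitney N r ?w = whitney N r ?w'" for N :: "'a matroid"
    proof (rule whitney_cong)
      fix j assume j: "j \<in> {1..r}"
      then have "(b(Suc r := int i)) (j - 1) = b (j - 1)" by auto
      then show "?w j = ?w' j" using step[OF b j] by simp
    qed
    ultimately show ?thesis by (simp only: whitney_Suc of_nat_sum)
  qed
  then show ?thesis by (subst sum.swap) (rule sum.cong, auto)
qed

text \<open>Subsets of \<open>{1..Suc r}\<close> are split by whether they contain
  \<open>Suc r\<close>. Without it, \<open>i\<close> is passed down to the contraction; with it,
  \<open>e\<close> is passed down and the sign changes. This has the shape of the recursion for
  \<open>kl_coeff\<close>.\<close>

lemma whitney_sum_Suc:
  "whitney_sum M (Suc r) i e =
     (\<Sum>k<i. (\<Sum>F | F \<in> flats M \<and> crk M F = i + k. whitney_sum (contraction M F) r k i)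
           - (\<Sum>F | F \<in> flats M \<and> crk M F = e + k. whitney_sum (contraction M F) r k e))"
proof -
  define A where "A S k = (\<Sum>b\<in>chain_seqs k r. int (whitney M (Suc r)
      (\<lambda>j. (b(Suc r := int i, Suc (Suc r) := int e)) (next_notin S j) + (b(Suc r := int i)) (j - 1))))"
    for S k
  define T where "T N x S k = (\<Sum>b\<in>chain_seqs k r.
            int (whitney N r (\<lambda>j. (b(Suc r := int x)) (next_notin S j) + b (j - 1))))"
    for N :: "'a matroid" and x S k
  have 1: "A S k = (\<Sum>F | F \<in> flats M \<and> crk M F = i + k. T (contraction M F) i S k)"
    if S: "S \<subseteq> {1..r}" for S k
    unfolding A_def T_def
  proof (rule sum_whitney_chain_Suc)
    show "next_notin S (Suc r) = Suc r" using S by (intro next_notin_self) auto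
    fix b :: "nat \<Rightarrow> int" and j assume "j \<in> {1..r}"
    \<comment> \<open>Successors are at most \<open>Suc r\<close>, so the entry \<open>e\<close> is
      never read.\<close>
    then show "(b(Suc r := int i, Suc (Suc r) := int e)) (next_notin S j) = (b(Suc r := int i)) (next_notin S j)"
      using next_notin_le[OF S, of j] by auto
  qed auto
  have 2: "A (insert (Suc r) S) k = (\<Sum>F | F \<in> flats M \<and> crk M F = e + k. T (contraction M F) e S k)"
    if S: "S \<subseteq> {1..r}" for S k
    unfolding A_def T_def
  proof (rule sum_whitney_chain_Suc)
    have "next_notin S (Suc r) = Suc r" using S by (intro next_notin_self) auto
    then show "next_notin (insert (Suc r) S) (Suc r) = Suc (Suc r)"
      using S by (simp add: next_notin_insert_Suc)
    fix b :: "nat \<Rightarrow> int" and j assume "j \<in> {1..r}"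
    then show "(b(Suc r := int i, Suc (Suc r) := int e)) (next_notin (insert (Suc r) S) j)
        = (b(Suc r := int e)) (next_notin S j)"
      using next_notin_le[OF S, of j] by (auto simp: next_notin_insert_Suc[OF S])
  qed auto
  have ws: "whitney_sum N r k x = (\<Sum>S\<in>Pow {1..r}. (-1) ^ card S * T N x S k)" for N k x
    by (simp add: whitney_sum_def T_def)
  have P: "Pow {1..Suc r} = Pow {1..r} \<union> insert (Suc r) ` Pow {1..r}"
    by (simp add: atLeastAtMostSuc_conv Pow_insert)
  have disj: "Pow {1..r} \<inter> insert (Suc r) ` Pow {1..r} = {}" by auto
  have inj: "inj_on (insert (Suc r)) (Pow {1..r})"
  proof (rule inj_onI)
    fix S T assume "S \<in> Pow {1..r}" "T \<in> Pow {1..r}" "insert (Suc r) S = insert (Suc r) T"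
    moreover from this have "Suc r \<notin> S" "Suc r \<notin> T" by auto
    ultimately show "S = T" by (simp add: insert_ident)
  qed
  have "whitney_sum M (Suc r) i e = (\<Sum>S\<in>Pow {1..Suc r}. (-1) ^ card S * (\<Sum>k<i. A S k))"
    by (simp add: whitney_sum_def sum_chain_seqs_Suc A_def)
  also have "\<dots> = (\<Sum>S\<in>Pow {1..r}. (-1) ^ card S * (\<Sum>k<i. A S k))
      + (\<Sum>S\<in>Pow {1..r}. (-1) ^ card (insert (Suc r) S) * (\<Sum>k<i. A (insert (Suc r) S) k))"
    by (simp only: P sum.union_disjoint[OF _ _ disj] sum.reindex[OF inj] o_def finite_Pow_iff
        finite_atLeastAtMost finite_imageI)
  \<comment> \<open>Inserting the new element \<open>Suc r\<close> raises the cardinality by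
    one.\<close>
  also have "(\<Sum>S\<in>Pow {1..r}. (-1) ^ card (insert (Suc r) S) * (\<Sum>k<i. A (insert (Suc r) S) k))
      = - (\<Sum>S\<in>Pow {1..r}. (-1) ^ card S * (\<Sum>k<i. A (insert (Suc r) S) k))"
    unfolding sum_negf[symmetric]
  proof (rule sum.cong)
    fix S assume "S \<in> Pow {1..r}"
    then have "finite S" "Suc r \<notin> S" by (auto intro: finite_subset)
    then show "(-1) ^ card (insert (Suc r) S) * (\<Sum>k<i. A (insert (Suc r) S) k)
        = - ((-1) ^ card S * (\<Sum>k<i. A (insert (Suc r) S) k))" by simp
  qed simp
  also have "(\<Sum>S\<in>Pow {1..r}. (-1) ^ card S * (\<Sum>k<i. A S k))
      = (\<Sum>k<i. \<Sum>F | F \<in> flats M \<and> crk M F = i + k. whitney_sum (contraction M F) r k i)"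
  proof -
    have "(\<Sum>S\<in>Pow {1..r}. (-1) ^ card S * (\<Sum>k<i. A S k))
      = (\<Sum>S\<in>Pow {1..r}. \<Sum>k<i. \<Sum>F | F \<in> flats M \<and> crk M F = i + k. (-1) ^ card S * T (contraction M F) i S k)"
      by (intro sum.cong refl) (simp add: 1 sum_distrib_left)
    also have "\<dots> = (\<Sum>k<i. \<Sum>F | F \<in> flats M \<and> crk M F = i + k. whitney_sum (contraction M F) r k i)"
      unfolding ws by (subst sum.swap) (intro sum.cong refl sum.swap)
    finally show ?thesis .
  qed
  also have "(\<Sum>S\<in>Pow {1..r}. (-1) ^ card S * (\<Sum>k<i. A (insert (Suc r) S) k))
      = (\<Sum>k<i. \<Sum>F | F \<in> flats M \<and> crk M F = e + k. whitney_sum (contraction M F) r k e)"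
  proof -
    have "(\<Sum>S\<in>Pow {1..r}. (-1) ^ card S * (\<Sum>k<i. A (insert (Suc r) S) k))
      = (\<Sum>S\<in>Pow {1..r}. \<Sum>k<i. \<Sum>F | F \<in> flats M \<and> crk M F = e + k. (-1) ^ card S * T (contraction M F) e S k)"
      by (intro sum.cong refl) (simp add: 2 sum_distrib_left)
    also have "\<dots> = (\<Sum>k<i. \<Sum>F | F \<in> flats M \<and> crk M F = e + k. whitney_sum (contraction M F) r k e)"
      unfolding ws by (subst sum.swap) (intro sum.cong refl sum.swap)
    finally show ?thesis .
  qed
  finally show ?thesis by (simp add: sum_subtractf)
qed

text \<open>Both sides obey the same recursion. A contraction of rank \<open>x + k\<close> with
  index \<open>k\<close> has last entry \<open>x + k - k = x\<close>, so \<open>x\<close> is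
  \<open>i\<close> in the positive sum and \<open>rk M - i\<close> in the negative one.\<close>

lemma kl_coeff_eq_whitney_sum:
  "2 * i < rk M \<Longrightarrow> kl_coeff M i = (\<Sum>r\<le>i. whitney_sum M r i (rk M - i))"
proof (induction i arbitrary: M rule: less_induct)
  case (less i)
  show ?case
  proof (cases i)
    case 0
    then show ?thesis by (simp add: whitney_sum_0)
  next
    case (Suc i')
    have IH: "kl_coeff (contraction M F) k = (\<Sum>r<i. whitney_sum (contraction M F) r k x)"
      if "k < i" "k < x" "F \<in> flats M" "crk M F = x + k" for F k x
    proof -
      have "kl_coeff (contraction M F) k = (\<Sum>r\<le>k. whitney_sum (contraction M F) r k x)"
        using less.IH[of k "contraction M F"] that by (simp add: rk_contraction)
      \<comment> \<open>The terms with \<open>k < r\<close> vanish; the common range of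
        \<open>r\<close> allows the sums over \<open>r\<close> and \<open>F\<close> to be
        exchanged.\<close>
      also have "\<dots> = (\<Sum>r<i. whitney_sum (contraction M F) r k x)"
        using that by (intro sum.mono_neutral_left) (auto simp: whitney_sum_eq_0)
      finally show ?thesis .
    qed
    have S: "(\<Sum>F | F \<in> flats M \<and> crk M F = x + k. kl_coeff (contraction M F) k)
        = (\<Sum>r<i. \<Sum>F | F \<in> flats M \<and> crk M F = x + k. whitney_sum (contraction M F) r k x)"
      if "k < i" "k < x" for k x
      using that by (subst sum.swap) (intro sum.cong, auto simp: IH)
    have "kl_coeff M i =
        (\<Sum>k<i. (\<Sum>F | F \<in> flats M \<and> crk M F = i + k. kl_coeff (contraction M F) k)
              - (\<Sum>F | F \<in> flats M \<and> crk M F = rk M - i + k. kl_coeff (contraction M F) k))"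
      using less.prems Suc by (subst kl_coeff.simps) simp
    also have "\<dots> = (\<Sum>k<i. \<Sum>r<i.
          (\<Sum>F | F \<in> flats M \<and> crk M F = i + k. whitney_sum (contraction M F) r k i)
        - (\<Sum>F | F \<in> flats M \<and> crk M F = rk M - i + k. whitney_sum (contraction M F) r k (rk M - i)))"
      unfolding sum_subtractf using less.prems by (intro arg_cong2[where f = minus] sum.cong refl S) auto
    also have "\<dots> = (\<Sum>r<i. whitney_sum M (Suc r) i (rk M - i))"
      by (subst sum.swap) (simp add: whitney_sum_Suc)
    \<comment> \<open>The added term \<open>r = 0\<close> is zero because
      \<open>i > 0\<close>.\<close>
    also have "\<dots> = (\<Sum>r\<le>i. whitney_sum M r i (rk M - i))"
      using Suc by (simp add: sum.atMost_shift whitney_sum_0)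
    finally show ?thesis .
  qed
qed

lemma whitney_sum_index_seqs:
  assumes "2 * i < rk M"
  shows "whitney_sum M r i (rk M - i) =
    (\<Sum>S\<in>Pow {1..r}. (-1) ^ card S *
       (\<Sum>a\<in>index_seqs (rk M) i r.
          int (whitney M r (\<lambda>j. a (next_notin S j) + a (j - 1)))))"
proof -
  have "whitney M r (\<lambda>j. (b(Suc r := e)) (next_notin S j) + (b(Suc r := e)) (j - 1))
      = whitney M r (\<lambda>j. (b(Suc r := e)) (next_notin S j) + b (j - 1))" for b S and e :: int
    by (rule whitney_cong) auto
  moreover have "int (rk M - i) = int (rk M) - int i" using assms by simp
  ultimately show ?thesis
    using assms
    by (simp add: whitney_sum_def index_seqs_eq sum.reindex inj_on_chain_seqs_upd del: fun_upd_apply)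
qed

theorem theorem3p3:
  fixes M :: "'a matroid" and i :: nat
  assumes "i > 0"
  shows "coeff (KL_poly M) i =
    (\<Sum>r = 1..i. \<Sum>S\<in>Pow {1..r}. (-1) ^ card S *
       (\<Sum>a\<in>index_seqs (rk M) i r.
          int (whitney M r (\<lambda>j. a (next_notin S j) + a (j - 1)))))"
proof (cases "2 * i < rk M")
  case True
  have "coeff (KL_poly M) i = (\<Sum>r\<le>i. whitney_sum M r i (rk M - i))"
    by (simp add: KL_poly_eq_kl_poly coeff_kl_poly kl_coeff_eq_whitney_sum[OF True])
  also have "\<dots> = (\<Sum>r = 1..i. whitney_sum M r i (rk M - i))"
    using assms by (intro sum.mono_neutral_right) (auto simp: whitney_sum_0 not_less_eq_eq)
  finally show ?thesis by (simp only: whitney_sum_index_seqs[OF True])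
next
  case False
  \<comment> \<open>Both sides are 0: the left by the degree bound, the right because there are no
    index sequences.\<close>
  then show ?thesis
    using assms by (simp add: KL_poly_eq_kl_poly coeff_kl_poly kl_coeff_eq_0 index_seqs_eq)
qed

end
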